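(* All the Runge--Kutta--Munthe-Kaas (RKMK), Crouch--Grossman and commutator-free skeletons are equivariant.
   Context: Setting: $G$ is a Lie group (treated as a matrix group) with Lie algebra $\mathfrak g$, acting smoothly and transitively on a smooth manifold $M$; the action is written $g\cdot x$. $G$ acts on $\mathfrak g$ by $g\cdot\xi = g\xi g^{-1}$ and on $\nu\in C^\infty(M,\mathfrak g)$ by $(g\cdot\nu)(x) = g\cdot\nu(g^{-1}\cdot x)$. Skeleton: a stage tree is a finite tree (connected undirected graph without cycles) with $n$ vertices, two of which are singled out: the initial vertex $\circ$ and the final vertex $\bullet$. Motions are maps $\Psi_{i,j}\colon\mathfrak g^n\to G$, one for each ordered pair of adjacent vertices, with $\Psi_{i,j}(F)=\Psi_{j,i}(F)^{-1}$. Given $\nu\in C^\infty(M,\mathfrak g)$ and $x_0\in M$, the point $x_1=\Sigma(\nu)(x_0)$ is defined by the system: $X_\circ = x_0$; $X_i=\Psi_{i,j}(F)\cdot X_j$ for every edge $i,j$; $F_i=\nu(X_i)$ for every vertex $i$; $x_1=X_\bullet$, with unknowns $X_i\in M$, $F_i\in\mathfrak g$. Standing assumption: $\nu$ is always scaled so that this system has exactly one solution and $\Sigma(\nu)$ is a diffeomorphism. The map $\nu\mapsto\Sigma(\nu)$ is the skeleton. It is equivariant if $\Sigma(g\cdot\nu)(g\cdot x)=g\cdot\Sigma(\nu)(x)$ for all $g\in G$, $x\in M$ and $\nu$. In the skeletons considered, the motions have the form $\Psi_{i,j}=\Psi\circ\theta_{i,j}$, where the motion map $\Psi\colon\mathfrak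 g\to G$ is the exponential map (or, when $G$ is a quadratic matrix group, the Cayley map $\xi\mapsto(1-\xi/2)^{-1}(1+\xi/2)$ where defined), and where the transition functions $\theta_{i,j}\colon\mathfrak g^n\to\mathfrak g$ satisfy $\theta_{i,j}=-\theta_{j,i}$ and are as follows: - RKMK skeleton: every vertex other than $\circ$ is adjacent to $\circ$, and each $\theta_{i,\circ}(F)$ is a fixed real linear combination of the components $F_j$ of $F$ and their iterated commutators; - Crouch--Grossman skeleton: each $\theta_{i,j}(F)$ is a fixed real multiple of a single component $F_\ell$ of $F$; - commutator-free skeleton: each $\theta_{i,j}(F)$ is a fixed real linear combination of components of $F$. *)

theory Defs
  imports "HOL-Analysis.Analysis"
begin

section \<open>Matrix Lie groups\<close>

type_synonym 'n mat = "real^'n^'n"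

text \<open>A matrix Lie group is a subgroup of \<open>GL(n, \<real>)\<close> that is closed in \<open>GL(n, \<real>)\<close> (not necessarily
  in the space of all matrices). Complex matrix groups are covered through the usual embedding of
  \<open>GL(n, \<complex>)\<close> into \<open>GL(2n, \<real>)\<close>. On square matrices \<open>*\<close> and \<open>^\<close> (hence also \<open>exp\<close>) are
  componentwise operations, so the matrix exponential is defined by its power series.\<close>

definition matrix_lie_group :: "'n::finite mat set \<Rightarrow> bool" where
  "matrix_lie_group G \<longleftrightarrow>
     mat 1 \<in> G \<and>
     (\<forall>g\<in>G. \<forall>h\<in>G. g ** h \<in> G) \<and>
     (\<forall>g\<in>G. invertible g \<and> matrix_inv g \<in> G) \<and>
     closedin (top_of_set {A. invertible A}) G"

definition matrix_exp :: "'n::finite mat \<Rightarrow> 'n mat" where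
  "matrix_exp A = (\<Sum>k. (1 / fact k) *\<^sub>R (((\<lambda>B. A ** B) ^^ k) (mat 1)))"

definition lie_algebra :: "'n::finite mat set \<Rightarrow> 'n mat set" where
  "lie_algebra G = {\<xi>. \<forall>t::real. matrix_exp (t *\<^sub>R \<xi>) \<in> G}"

definition commutator :: "'n::finite mat \<Rightarrow> 'n mat \<Rightarrow> 'n mat" where
  "commutator \<xi> \<eta> = \<xi> ** \<eta> - \<eta> ** \<xi>"

definition quadratic_group :: "'n::finite mat set \<Rightarrow> bool" where
  "quadratic_group G \<longleftrightarrow> (\<exists>J. G = {g. invertible g \<and> transpose g ** J ** g = J})"


section \<open>Smooth manifolds and smooth actions\<close>

primrec Ck_on :: "nat \<Rightarrow> 'a::euclidean_space set \<Rightarrow> ('a \<Rightarrow> 'b::real_normed_vector) \<Rightarrow> bool" where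
  "Ck_on 0 U f \<longleftrightarrow> continuous_on U f"
| "Ck_on (Suc k) U f \<longleftrightarrow>
     (\<exists>f'. (\<forall>x\<in>U. (f has_derivative f' x) (at x)) \<and> (\<forall>v. Ck_on k U (\<lambda>x. f' x v)))"

text \<open>Smoothness on an arbitrary subset of a Euclidean space, by local smooth extension. On a
  (relatively open subset of a) subspace or embedded submanifold this is smoothness in the
  intrinsic sense.\<close>

definition smooth_on :: "'a::euclidean_space set \<Rightarrow> ('a \<Rightarrow> 'b::real_normed_vector) \<Rightarrow> bool" where
  "smooth_on S f \<longleftrightarrow>
     (\<forall>x\<in>S. \<exists>U h. open U \<and> x \<in> U \<and> (\<forall>k. Ck_on k U h) \<and> (\<forall>y\<in>S \<inter> U. h y = f y))"

text \<open>The manifold is the type \<open>'m\<close> itself. A chart \<open>(U, \<phi>)\<close> uses only the values of \<open>\<phi>\<close> on \<open>U\<close> and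
  takes values in a fixed linear subspace \<open>V\<close>, so the manifold has dimension \<open>dim V\<close>; a subspace is
  used rather than a full Euclidean type because the latter never has dimension 0. The atlas need
  not be maximal.\<close>

definition smooth_manifold ::
  "'e::euclidean_space set \<Rightarrow> ('m::{t2_space,second_countable_topology} set \<times> ('m \<Rightarrow> 'e)) set \<Rightarrow> bool"
where
  "smooth_manifold V A \<longleftrightarrow>
     subspace V \<and>
     (\<Union>(U, \<phi>)\<in>A. U) = UNIV \<and>
     (\<forall>(U, \<phi>)\<in>A. open U \<and> openin (top_of_set V) (\<phi> ` U) \<and>
        homeomorphism U (\<phi> ` U) \<phi> (inv_into U \<phi>)) \<and>
     (\<forall>(U, \<phi>)\<in>A. \<forall>(W, \<psi>)\<in>A. smooth_on (\<phi> ` (U \<inter> W)) (\<psi> \<circ> inv_into U \<phi>))"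

definition smooth_map ::
  "('m::{t2_space,second_countable_topology} set \<times> ('m \<Rightarrow> 'e::euclidean_space)) set \<Rightarrow>
   ('m \<Rightarrow> 'm) \<Rightarrow> bool" where
  "smooth_map A f \<longleftrightarrow>
     continuous_on UNIV f \<and>
     (\<forall>(U, \<phi>)\<in>A. \<forall>(W, \<psi>)\<in>A.
        smooth_on (\<phi> ` (U \<inter> f -` W)) (\<psi> \<circ> f \<circ> inv_into U \<phi>))"

definition diffeo ::
  "('m::{t2_space,second_countable_topology} set \<times> ('m \<Rightarrow> 'e::euclidean_space)) set \<Rightarrow>
   ('m \<Rightarrow> 'm) \<Rightarrow> bool" where
  "diffeo A f \<longleftrightarrow> bij f \<and> smooth_map A f \<and> smooth_map A (inv f)"

definition smooth_functions ::
  "('m::{t2_space,second_countable_topology} set \<times> ('m \<Rightarrow> 'e::euclidean_space)) set \<Rightarrow>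
   'n::finite mat set \<Rightarrow> ('m \<Rightarrow> 'n mat) set" where
  "smooth_functions A \<gg> =
     {\<nu>. range \<nu> \<subseteq> \<gg> \<and> (\<forall>(U, \<phi>)\<in>A. smooth_on (\<phi> ` U) (\<nu> \<circ> inv_into U \<phi>))}"

definition smooth_transitive_action ::
  "('m::{t2_space,second_countable_topology} set \<times> ('m \<Rightarrow> 'e::euclidean_space)) set \<Rightarrow>
   'n::finite mat set \<Rightarrow> ('n mat \<Rightarrow> 'm \<Rightarrow> 'm) \<Rightarrow> bool" where
  "smooth_transitive_action A G act \<longleftrightarrow>
     (\<forall>x. act (mat 1) x = x) \<and>
     (\<forall>g\<in>G. \<forall>h\<in>G. \<forall>x. act (g ** h) x = act g (act h x)) \<and>
     continuous_on (G \<times> UNIV) (\<lambda>(g, x). act g x) \<and>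
     (\<forall>(U, \<phi>)\<in>A. \<forall>(W, \<psi>)\<in>A.
        smooth_on {(g, y). g \<in> G \<and> y \<in> \<phi> ` U \<and> act g (inv_into U \<phi> y) \<in> W}
          (\<lambda>(g, y). \<psi> (act g (inv_into U \<phi> y)))) \<and>
     (\<forall>x y. \<exists>g\<in>G. act g x = y)"

definition act_field ::
  "('n::finite mat \<Rightarrow> 'm \<Rightarrow> 'm) \<Rightarrow> 'n mat \<Rightarrow> ('m \<Rightarrow> 'n mat) \<Rightarrow> 'm \<Rightarrow> 'n mat" where
  "act_field act g \<nu> = (\<lambda>x. g ** \<nu> (act (matrix_inv g) x) ** matrix_inv g)"


section \<open>Skeletons\<close>

text \<open>The vertices are the elements of the finite type \<open>'v\<close>.\<close>

definition stage_tree :: "('v::finite \<Rightarrow> 'v \<Rightarrow> bool) \<Rightarrow> 'v \<Rightarrow> 'v \<Rightarrow> bool" where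
  "stage_tree adj ini fin \<longleftrightarrow>
     symp adj \<and> irreflp adj \<and>
     (\<forall>i j. adj\<^sup>*\<^sup>* i j) \<and>
     (\<nexists>p. 3 \<le> length p \<and> distinct p \<and> successively adj p \<and> adj (last p) (hd p)) \<and>
     ini \<noteq> fin"

text \<open>A motion is a partial map, because the Cayley map is not defined everywhere; a stage solution
  requires all motions of the tree to be defined at \<open>F\<close>. Both orientations of every edge occur.\<close>

type_synonym ('v, 'n) motions = "'v \<Rightarrow> 'v \<Rightarrow> ('v \<Rightarrow> 'n mat) \<Rightarrow> 'n mat option"

definition stage_solution ::
  "('n::finite mat \<Rightarrow> 'm \<Rightarrow> 'm) \<Rightarrow> ('v::finite \<Rightarrow> 'v \<Rightarrow> bool) \<Rightarrow> 'v \<Rightarrow> ('v, 'n) motions \<Rightarrow>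
   ('m \<Rightarrow> 'n mat) \<Rightarrow> 'm \<Rightarrow> ('v \<Rightarrow> 'm) \<Rightarrow> ('v \<Rightarrow> 'n mat) \<Rightarrow> bool" where
  "stage_solution act adj ini \<Psi> \<nu> x0 X F \<longleftrightarrow>
     X ini = x0 \<and>
     (\<forall>i j. adj i j \<longrightarrow> (\<exists>h. \<Psi> i j F = Some h \<and> X i = act h (X j))) \<and>
     (\<forall>i. F i = \<nu> (X i))"

definition skeleton ::
  "('n::finite mat \<Rightarrow> 'm \<Rightarrow> 'm) \<Rightarrow> ('v::finite \<Rightarrow> 'v \<Rightarrow> bool) \<Rightarrow> 'v \<Rightarrow> 'v \<Rightarrow> ('v, 'n) motions \<Rightarrow>
   ('m \<Rightarrow> 'n mat) \<Rightarrow> 'm \<Rightarrow> 'm" where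
  "skeleton act adj ini fin \<Psi> \<nu> x0 =
     (THE x1. \<exists>X F. stage_solution act adj ini \<Psi> \<nu> x0 X F \<and> x1 = X fin)"

text \<open>The fields that are scaled so that the skeleton is well defined and a diffeomorphism.\<close>

definition admissible_fields ::
  "('m::{t2_space,second_countable_topology} set \<times> ('m \<Rightarrow> 'e::euclidean_space)) set \<Rightarrow>
   'n::finite mat set \<Rightarrow> ('n mat \<Rightarrow> 'm \<Rightarrow> 'm) \<Rightarrow>
   ('v::finite \<Rightarrow> 'v \<Rightarrow> bool) \<Rightarrow> 'v \<Rightarrow> 'v \<Rightarrow> ('v, 'n) motions \<Rightarrow> ('m \<Rightarrow> 'n mat) set" where
  "admissible_fields A G act adj ini fin \<Psi> =
     {\<nu> \<in> smooth_functions A (lie_algebra G).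
        (\<forall>x0. \<exists>!(X, F). stage_solution act adj ini \<Psi> \<nu> x0 X F) \<and>
        diffeo A (skeleton act adj ini fin \<Psi> \<nu>)}"

definition equivariant_skeleton ::
  "('m::{t2_space,second_countable_topology} set \<times> ('m \<Rightarrow> 'e::euclidean_space)) set \<Rightarrow>
   'n::finite mat set \<Rightarrow> ('n mat \<Rightarrow> 'm \<Rightarrow> 'm) \<Rightarrow>
   ('v::finite \<Rightarrow> 'v \<Rightarrow> bool) \<Rightarrow> 'v \<Rightarrow> 'v \<Rightarrow> ('v, 'n) motions \<Rightarrow> bool" where
  "equivariant_skeleton A G act adj ini fin \<Psi> \<longleftrightarrow>
     (\<forall>g\<in>G. \<forall>\<nu>\<in>admissible_fields A G act adj ini fin \<Psi>. \<forall>x.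
        skeleton act adj ini fin \<Psi> (act_field act g \<nu>) (act g x) =
          act g (skeleton act adj ini fin \<Psi> \<nu> x))"


section \<open>Motion maps and transition functions\<close>

definition exp_motion :: "'n::finite mat \<Rightarrow> 'n mat option" where
  "exp_motion \<xi> = Some (matrix_exp \<xi>)"

definition cayley_motion :: "'n::finite mat \<Rightarrow> 'n mat option" where
  "cayley_motion \<xi> =
     (if invertible (mat 1 - (1/2) *\<^sub>R \<xi>)
      then Some (matrix_inv (mat 1 - (1/2) *\<^sub>R \<xi>) ** (mat 1 + (1/2) *\<^sub>R \<xi>)) else None)"

type_synonym ('v, 'n) transitions = "'v \<Rightarrow> 'v \<Rightarrow> ('v \<Rightarrow> 'n mat) \<Rightarrow> 'n mat"

definition motions_of ::
  "('n mat \<Rightarrow> 'n mat option) \<Rightarrow> ('v, 'n) transitions \<Rightarrow> ('v, 'n) motions" where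
  "motions_of \<Psi> \<theta> = (\<lambda>i j. \<Psi> \<circ> \<theta> i j)"

definition transition_functions ::
  "'n::finite mat set \<Rightarrow> ('v::finite \<Rightarrow> 'v \<Rightarrow> bool) \<Rightarrow> ('v, 'n) transitions \<Rightarrow> bool" where
  "transition_functions \<gg> adj \<theta> \<longleftrightarrow>
     (\<forall>i j. adj i j \<longrightarrow> (\<forall>F. range F \<subseteq> \<gg> \<longrightarrow> \<theta> i j F \<in> \<gg> \<and> \<theta> i j F = - \<theta> j i F))"

datatype 'v lie_word = Component 'v | Comm "'v lie_word" "'v lie_word"

primrec eval_word :: "('v \<Rightarrow> 'n::finite mat) \<Rightarrow> 'v lie_word \<Rightarrow> 'n mat" where
  "eval_word F (Component l) = F l"
| "eval_word F (Comm u w) = commutator (eval_word F u) (eval_word F w)"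

definition rkmk ::
  "'n::finite mat set \<Rightarrow> ('v::finite \<Rightarrow> 'v \<Rightarrow> bool) \<Rightarrow> 'v \<Rightarrow> ('v, 'n) transitions \<Rightarrow> bool" where
  "rkmk \<gg> adj ini \<theta> \<longleftrightarrow>
     (\<forall>i. i \<noteq> ini \<longrightarrow> adj i ini \<and>
        (\<exists>T c. finite T \<and>
           (\<forall>F. range F \<subseteq> \<gg> \<longrightarrow> \<theta> i ini F = (\<Sum>w\<in>T. (c w :: real) *\<^sub>R eval_word F w))))"

definition crouch_grossman ::
  "'n::finite mat set \<Rightarrow> ('v::finite \<Rightarrow> 'v \<Rightarrow> bool) \<Rightarrow> ('v, 'n) transitions \<Rightarrow> bool" where
  "crouch_grossman \<gg> adj \<theta> \<longleftrightarrow>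
     (\<forall>i j. adj i j \<longrightarrow>
        (\<exists>l (c::real). \<forall>F. range F \<subseteq> \<gg> \<longrightarrow> \<theta> i j F = c *\<^sub>R F l))"

definition commutator_free ::
  "'n::finite mat set \<Rightarrow> ('v::finite \<Rightarrow> 'v \<Rightarrow> bool) \<Rightarrow> ('v, 'n) transitions \<Rightarrow> bool" where
  "commutator_free \<gg> adj \<theta> \<longleftrightarrow>
     (\<forall>i j. adj i j \<longrightarrow>
        (\<exists>c. \<forall>F. range F \<subseteq> \<gg> \<longrightarrow> \<theta> i j F = (\<Sum>l\<in>UNIV. (c l :: real) *\<^sub>R F l)))"

end

theory Submission
  imports Defs
begin

text \<open>The exponential and the Cayley map, as well as linear combinations of iterated commutators,
  commute with conjugation by \<open>g\<close>. Hence \<open>(X, F) \<mapsto> (g \<cdot> X, g F g\<^sup>-\<^sup>1)\<close> carries the solutions of the stage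
  equations for \<open>\<nu>\<close> at \<open>x\<close> to those for \<open>g \<cdot> \<nu>\<close> at \<open>g \<cdot> x\<close>, with inverse given by \<open>g\<^sup>-\<^sup>1\<close>, and uniqueness of the
  solution gives equivariance. The motions lie in \<open>G\<close>; for the Cayley map this rests on the
  infinitesimal form \<open>\<xi>\<^sup>T J + J \<xi> = 0\<close> of the quadratic relation.\<close>

section \<open>Conjugation\<close>

text \<open>Defined on all matrices, so that the same map serves as the adjoint action on the Lie
  algebra and as the inner automorphism applied to the motions themselves.\<close>

definition conjugate :: "'n::finite mat \<Rightarrow> 'n mat \<Rightarrow> 'n mat" where
  "conjugate g \<xi> = g ** \<xi> ** matrix_inv g"

lemma
  fixes A :: "'n::finite mat"
  assumes "invertible A"
  shows matrix_inv_right: "A ** matrix_inv A = mat 1"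
    and matrix_inv_left: "matrix_inv A ** A = mat 1"
  using someI_ex[of "\<lambda>B. A ** B = mat 1 \<and> B ** A = mat 1"] assms
  unfolding invertible_def matrix_inv_def by blast+

lemma matrix_inv_unique:
  fixes A B :: "'n::finite mat"
  assumes "A ** B = mat 1"
  shows "matrix_inv A = B"
proof -
  have BA: "B ** A = mat 1"
    using assms matrix_left_right_inverse by blast
  then have "invertible A"
    using assms invertible_def by blast
  then have "matrix_inv A ** A = mat 1"
    by (rule matrix_inv_left)
  then show ?thesis
    by (metis assms matrix_mul_assoc matrix_mul_lid matrix_mul_rid)
qed

lemma matrix_inv_matrix_inv:
  fixes A :: "'n::finite mat"
  shows "invertible A \<Longrightarrow> matrix_inv (matrix_inv A) = A"
  by (rule matrix_inv_unique) (rule matrix_inv_left)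

text \<open>The type-class product \<open>*\<close> on matrices is componentwise, so distributivity,
  norm bounds and the product rule for derivatives of \<open>**\<close> are all drawn from this
  fact.\<close>

lemma bounded_bilinear_matrix_mul: "bounded_bilinear ((**) :: 'n::finite mat \<Rightarrow> 'n mat \<Rightarrow> 'n mat)"
  unfolding bilinear_conv_bounded_bilinear[symmetric] bilinear_def
  by (auto intro!: linearI
      simp: matrix_matrix_mult_def vec_eq_iff sum.distrib sum_distrib_left algebra_simps)

lemma bounded_linear_conjugate: "bounded_linear (conjugate g)"
  unfolding conjugate_def
  using bounded_linear_compose
    [OF bounded_bilinear.bounded_linear_left[OF bounded_bilinear_matrix_mul]
      bounded_bilinear.bounded_linear_right[OF bounded_bilinear_matrix_mul]] .

lemma linear_conjugate: "linear (conjugate g)"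
  by (rule bounded_linear.linear[OF bounded_linear_conjugate])

lemma conjugate_mult:
  assumes "invertible g"
  shows "conjugate g (A ** B) = conjugate g A ** conjugate g B"
proof -
  have "conjugate g A ** conjugate g B = g ** A ** (matrix_inv g ** g) ** B ** matrix_inv g"
    by (simp add: conjugate_def matrix_mul_assoc)
  then show ?thesis
    by (simp add: conjugate_def matrix_inv_left[OF assms] matrix_mul_assoc)
qed

lemma conjugate_one: "invertible g \<Longrightarrow> conjugate g (mat 1) = mat 1"
  by (simp add: conjugate_def matrix_inv_right)

lemma conjugate_matrix_inv_conjugate:
  assumes "invertible g"
  shows "conjugate (matrix_inv g) (conjugate g A) = A"
proof -
  have "conjugate (matrix_inv g) (conjugate g A)
      = (matrix_inv g ** g) ** A ** (matrix_inv g ** g)"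
    by (simp add: conjugate_def matrix_mul_assoc matrix_inv_matrix_inv[OF assms])
  then show ?thesis
    by (simp add: matrix_inv_left[OF assms])
qed

lemma conjugate_commutator:
  "invertible g \<Longrightarrow> conjugate g (commutator A B) = commutator (conjugate g A) (conjugate g B)"
  by (simp add: commutator_def linear_diff[OF linear_conjugate] conjugate_mult)

text \<open>Conjugation preserves commutators, hence by induction every iterated commutator.\<close>

lemma eval_word_conjugate:
  "invertible g \<Longrightarrow> eval_word (\<lambda>l. conjugate g (F l)) w = conjugate g (eval_word F w)"
  by (induction w) (simp_all add: conjugate_commutator)

lemma conjugate_matrix_inv:
  assumes "invertible g" "invertible A"
  shows "invertible (conjugate g A)" "matrix_inv (conjugate g A) = conjugate g (matrix_inv A)"
proof -
  have 1: "conjugate g A ** conjugate g (matrix_inv A) = mat 1"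
    by (simp add: assms conjugate_mult[symmetric] matrix_inv_right conjugate_one)
  then show "invertible (conjugate g A)"
    using invertible_def matrix_left_right_inverse by blast
  show "matrix_inv (conjugate g A) = conjugate g (matrix_inv A)"
    using 1 by (rule matrix_inv_unique)
qed


section \<open>The matrix exponential\<close>

text \<open>Comparison with the scalar exponential series at \<open>norm A * K\<close>. The bound
  \<open>K\<close> of the bilinear product takes the place of submultiplicativity, and the factor
  \<open>norm (mat 1)\<close> is kept because it need not be 1 in the Euclidean norm.\<close>

lemma summable_matrix_exp:
  fixes A :: "'n::finite mat"
  shows "summable (\<lambda>k. (1 / fact k) *\<^sub>R (((\<lambda>B. A ** B) ^^ k) (mat 1)))"
proof -
  obtain K where K: "\<And>(A :: 'n mat) (B :: 'n mat). norm (A ** B) \<le> norm A * norm B * K" "0 \<le> K"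
    using bounded_bilinear.nonneg_bounded[OF bounded_bilinear_matrix_mul] by metis
  have pow: "norm (((\<lambda>B. A ** B) ^^ k) (mat 1)) \<le> (norm A * K) ^ k * norm (mat 1 :: 'n mat)" for k
  proof (induction k)
    case (Suc k)
    have "norm (((\<lambda>B. A ** B) ^^ Suc k) (mat 1)) \<le> (norm A * K) * norm (((\<lambda>B. A ** B) ^^ k) (mat 1))"
      using K(1)[of A "((\<lambda>B. A ** B) ^^ k) (mat 1)"] by (simp add: mult_ac)
    also have "\<dots> \<le> (norm A * K) * ((norm A * K) ^ k * norm (mat 1 :: 'n mat))"
      using Suc K(2) by (intro mult_left_mono) auto
    finally show ?case by (simp add: mult_ac)
  qed simp
  show ?thesis
  proof (rule summable_comparison_test'[where N = 0])
    show "summable (\<lambda>k. inverse (fact k) * (norm A * K) ^ k * norm (mat 1 :: 'n mat))"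
      by (intro summable_mult2 summable_exp)
    show "norm ((1 / fact k) *\<^sub>R (((\<lambda>B. A ** B) ^^ k) (mat 1)))
        \<le> inverse (fact k) * (norm A * K) ^ k * norm (mat 1 :: 'n mat)" for k
      using pow[of k] by (simp add: field_simps)
  qed
qed

text \<open>Conjugation is multiplicative, so it commutes with powers; being bounded and linear, it
  passes through the convergent series.\<close>

lemma matrix_exp_conjugate:
  assumes "invertible g"
  shows "matrix_exp (conjugate g A) = conjugate g (matrix_exp A)"
proof -
  have pow: "((\<lambda>B. conjugate g A ** B) ^^ k) (mat 1) = conjugate g (((\<lambda>B. A ** B) ^^ k) (mat 1))" for k
    by (induction k) (simp_all add: assms conjugate_one conjugate_mult)
  show ?thesis
    unfolding matrix_exp_def pow bounded_linear.suminf[OF bounded_linear_conjugate summable_matrix_exp]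
    by (simp add: linear_cmul[OF linear_conjugate])
qed

lemma matrix_pow_scaleR:
  fixes A :: "'n::finite mat"
  shows "((\<lambda>B. (t *\<^sub>R A) ** B) ^^ k) (mat 1) = t ^ k *\<^sub>R (((\<lambda>B. A ** B) ^^ k) (mat 1))"
proof (induction k)
  case (Suc k)
  have "((\<lambda>B. (t *\<^sub>R A) ** B) ^^ Suc k) (mat 1)
      = (t *\<^sub>R A) ** (t ^ k *\<^sub>R (((\<lambda>B. A ** B) ^^ k) (mat 1)))"
    by (simp only: funpow.simps o_apply Suc)
  then show ?case
    by (simp add: bounded_bilinear.scaleR_left[OF bounded_bilinear_matrix_mul]
        bounded_bilinear.scaleR_right[OF bounded_bilinear_matrix_mul] mult.commute)
qed simp

text \<open>Links the definition of the Lie algebra by one-parameter subgroups to infinitesimal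
  conditions. Each matrix entry is a real power series in \<open>t\<close>, which can be
  differentiated termwise.\<close>

lemma has_vector_derivative_matrix_exp_0:
  fixes A :: "'n::finite mat"
  shows "((\<lambda>t. matrix_exp (t *\<^sub>R A)) has_vector_derivative A) (at 0)"
proof -
  have "((\<lambda>t. matrix_exp (t *\<^sub>R A) $ i $ j) has_real_derivative A $ i $ j) (at 0)" for i j
  proof -
    define c where "c k = (1 / fact k) * ((((\<lambda>B. A ** B) ^^ k) (mat 1)) $ i $ j)" for k
    have lin: "bounded_linear (\<lambda>M :: 'n mat. M $ i $ j)"
      by (intro bounded_linear_compose[OF bounded_linear_vec_nth bounded_linear_vec_nth])
    have coeff: "((1 / fact k) *\<^sub>R (((\<lambda>B. (t *\<^sub>R A) ** B) ^^ k) (mat 1))) $ i $ j = c k * t ^ k" for k t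
      by (simp add: matrix_pow_scaleR c_def)
    have summ: "summable (\<lambda>k. c k * t ^ k)" for t
      using bounded_linear.summable[OF lin summable_matrix_exp[of "t *\<^sub>R A"]] by (simp only: coeff)
    have "matrix_exp (t *\<^sub>R A) $ i $ j = (\<Sum>k. c k * t ^ k)" for t
      unfolding matrix_exp_def bounded_linear.suminf[OF lin summable_matrix_exp] coeff ..
    \<comment> \<open>Only the derivative at 0 is wanted, so convergence at the single point
      \<open>t = 1\<close> puts 0 safely inside the disc of convergence.\<close>
    moreover have "((\<lambda>t. \<Sum>k. c k * t ^ k) has_real_derivative (\<Sum>k. diffs c k * 0 ^ k)) (at 0)"
      by (rule termdiffs_strong[OF summ[of 1]]) simp
    \<comment> \<open>At 0 only the constant term \<open>diffs c 0 = c 1\<close> survives, and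
      \<open>c 1\<close> is the entry of the first power of \<open>A\<close>.\<close>
    moreover have "(\<Sum>k. diffs c k * 0 ^ k) = A $ i $ j"
      using powser_zero[of "diffs c"] by (simp add: diffs_def c_def)
    ultimately show ?thesis by simp
  qed
  then have "((\<lambda>t. matrix_exp (t *\<^sub>R A) $ i $ j) has_derivative (\<lambda>t. t * A $ i $ j)) (at 0)" for i j
    by (simp add: has_field_derivative_def mult_commute_abs)
  then show ?thesis
    unfolding has_vector_derivative_def
    by (subst has_derivative_componentwise_within) (auto simp: Basis_vec_def inner_axis)
qed

lemma matrix_exp_0: "matrix_exp (0 :: 'n::finite mat) = mat 1"
proof -
  have "(\<lambda>k. (1 / fact k) *\<^sub>R (((\<lambda>B. (0 :: 'n mat) ** B) ^^ k) (mat 1)))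
      = (\<lambda>k. if k = 0 then mat 1 else 0)"
  proof
    fix k show "(1 / fact k) *\<^sub>R (((\<lambda>B. (0 :: 'n mat) ** B) ^^ k) (mat 1)) = (if k = 0 then mat 1 else 0)"
      by (cases k) simp_all
  qed
  then show ?thesis
    unfolding matrix_exp_def by (simp only:) (subst suminf_finite[of "{0}"], auto)
qed

text \<open>Conjugating the one-parameter subgroup of \<open>\<xi>\<close> by \<open>g\<close> stays
  in \<open>G\<close>. This keeps conjugated stage values in the Lie algebra, where the formulas for
  the transition functions are available.\<close>

lemma lie_algebra_conjugate:
  assumes "matrix_lie_group G" "g \<in> G" "\<xi> \<in> lie_algebra G"
  shows "conjugate g \<xi> \<in> lie_algebra G"
proof -
  have "matrix_exp (t *\<^sub>R conjugate g \<xi>) \<in> G" for t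
  proof -
    have "matrix_exp (t *\<^sub>R conjugate g \<xi>) = conjugate g (matrix_exp (t *\<^sub>R \<xi>))"
      using assms by (simp add: linear_cmul[OF linear_conjugate, symmetric] matrix_exp_conjugate
          matrix_lie_group_def)
    then show ?thesis
      using assms by (simp add: conjugate_def lie_algebra_def matrix_lie_group_def)
  qed
  then show ?thesis
    by (simp add: lie_algebra_def)
qed

lemma matrix_exp_in_group: "\<xi> \<in> lie_algebra G \<Longrightarrow> matrix_exp \<xi> \<in> G"
  unfolding lie_algebra_def by (auto dest: spec[of _ 1])


section \<open>The Cayley map\<close>

text \<open>Differentiate the constant curve \<open>transpose (?E t) ** J ** ?E t\<close> at 0 by
  the product rule; its derivative must vanish.\<close>

lemma lie_algebra_quadratic_group:
  fixes J :: "'n::finite mat"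
  assumes "\<xi> \<in> lie_algebra {g. invertible g \<and> transpose g ** J ** g = J}"
  shows "transpose \<xi> ** J + J ** \<xi> = 0"
proof -
  let ?E = "\<lambda>t. matrix_exp (t *\<^sub>R \<xi>)"
  have const: "transpose (?E t) ** J ** ?E t = J" for t
    using assms by (simp add: lie_algebra_def)
  have tr: "bounded_linear (transpose :: 'n mat \<Rightarrow> 'n mat)"
    unfolding linear_conv_bounded_linear[symmetric]
    by (intro linearI) (simp_all add: transpose_def vec_eq_iff)
  have "((\<lambda>t. transpose (?E t)) has_vector_derivative transpose \<xi>) (at 0)"
    by (rule bounded_linear.has_vector_derivative[OF tr has_vector_derivative_matrix_exp_0])
  then have "((\<lambda>t. transpose (?E t) ** J) has_vector_derivative transpose \<xi> ** J) (at 0)"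
    by (rule bounded_linear.has_vector_derivative
        [OF bounded_bilinear.bounded_linear_left[OF bounded_bilinear_matrix_mul]])
  from bounded_bilinear.has_vector_derivative
    [OF bounded_bilinear_matrix_mul this has_vector_derivative_matrix_exp_0[of \<xi>]]
  have "((\<lambda>t. J) has_vector_derivative J ** \<xi> + transpose \<xi> ** J) (at 0)"
    by (simp add: const matrix_exp_0)
  then show ?thesis
    using vector_derivative_unique_at[OF _ has_vector_derivative_const] by (metis add.commute)
qed

lemma cayley_motion_SomeD:
  assumes "cayley_motion \<xi> = Some h"
  shows "invertible (mat 1 - (1/2) *\<^sub>R \<xi>)"
    and "h = matrix_inv (mat 1 - (1/2) *\<^sub>R \<xi>) ** (mat 1 + (1/2) *\<^sub>R \<xi>)"
  using assms unfolding cayley_motion_def by (auto split: if_splits)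

text \<open>Both factors, the inverse of \<open>1 - \<xi>/2\<close> and \<open>1 + \<xi>/2\<close>,
  are transported by conjugation. Invertibility is transported too, so definedness carries over
  along with the value.\<close>

lemma cayley_motion_conjugate:
  assumes "invertible g" "cayley_motion \<xi> = Some h"
  shows "cayley_motion (conjugate g \<xi>) = Some (conjugate g h)"
proof -
  have lin: "mat 1 - (1/2) *\<^sub>R conjugate g \<xi> = conjugate g (mat 1 - (1/2) *\<^sub>R \<xi>)"
    "mat 1 + (1/2) *\<^sub>R conjugate g \<xi> = conjugate g (mat 1 + (1/2) *\<^sub>R \<xi>)"
    by (simp_all only: conjugate_one[OF assms(1)] linear_diff[OF linear_conjugate]
        linear_add[OF linear_conjugate] linear_cmul[OF linear_conjugate])
  note inv = cayley_motion_SomeD(1)[OF assms(2)]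
  show ?thesis
    unfolding cayley_motion_def lin cayley_motion_SomeD(2)[OF assms(2)]
      conjugate_mult[OF assms(1)] conjugate_matrix_inv(2)[OF assms(1) inv]
    by (simp only: conjugate_matrix_inv(1)[OF assms(1) inv] if_True)
qed

text \<open>Definedness at \<open>-\<xi>\<close> is what makes the value at \<open>\<xi>\<close> invertible.\<close>

lemma cayley_motion_in_quadratic_group:
  fixes G :: "'n::finite mat set"
  assumes "quadratic_group G" "\<xi> \<in> lie_algebra G"
    and "cayley_motion \<xi> = Some h" "cayley_motion (- \<xi>) = Some k"
  shows "h \<in> G"
proof -
  obtain J where G: "G = {g. invertible g \<and> transpose g ** J ** g = J}"
    using assms(1) unfolding quadratic_group_def by blast
  define P where "P = mat 1 + (1/2) *\<^sub>R \<xi>"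
  define M where "M = mat 1 - (1/2) *\<^sub>R \<xi>"
  have M: "invertible M" and h: "h = matrix_inv M ** P"
    unfolding M_def P_def by (rule cayley_motion_SomeD[OF assms(3)])+
  \<comment> \<open>\<open>P\<close> is the matrix inverted by the Cayley map at
    \<open>- \<xi>\<close>.\<close>
  have P: "invertible P"
    using cayley_motion_SomeD(1)[OF assms(4)] by (simp add: P_def)
  note bil = bounded_bilinear.add_left[OF bounded_bilinear_matrix_mul]
    bounded_bilinear.add_right[OF bounded_bilinear_matrix_mul]
    bounded_bilinear.diff_left[OF bounded_bilinear_matrix_mul]
    bounded_bilinear.diff_right[OF bounded_bilinear_matrix_mul]
    bounded_bilinear.scaleR_left[OF bounded_bilinear_matrix_mul]
    bounded_bilinear.scaleR_right[OF bounded_bilinear_matrix_mul]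
  \<comment> \<open>Both are polynomials in \<open>\<xi>\<close>. Hence \<open>M\<close> can be
    cancelled from either side of \<open>h\<close>, giving \<open>M ** h = P\<close> and
    \<open>h ** M = P\<close>.\<close>
  have PM: "P ** M = M ** P"
    by (simp add: P_def M_def bil algebra_simps)
  have tP: "transpose P = mat 1 + (1/2) *\<^sub>R transpose \<xi>"
    and tM: "transpose M = mat 1 - (1/2) *\<^sub>R transpose \<xi>"
    by (simp_all add: P_def M_def transpose_def vec_eq_iff mat_def)
  have J\<xi>: "J ** \<xi> = - (transpose \<xi> ** J)"
    using lie_algebra_quadratic_group[of \<xi> J] assms(2) unfolding G
    by (simp add: eq_neg_iff_add_eq_0 add.commute)
  \<comment> \<open>Moving \<open>J\<close> across \<open>\<xi>\<close> costs a sign and a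
    transpose, which swaps the roles of \<open>P\<close> and \<open>M\<close>.\<close>
  have JM: "J ** M = transpose P ** J" and JP: "J ** P = transpose M ** J"
    unfolding tP tM by (simp_all add: P_def M_def bil J\<xi>)
  have eq: "transpose h ** J ** h = J"
  proof -
    have Mh: "M ** h = P"
      by (simp add: h matrix_mul_assoc matrix_inv_right[OF M])
    have hM: "h ** M = P"
      by (metis PM M h matrix_inv_left matrix_mul_assoc matrix_mul_lid)
    have th: "transpose M ** transpose h = transpose P"
      by (metis hM matrix_transpose_mul)
    \<comment> \<open>Multiplying by the invertible \<open>transpose M\<close> on the left removes
      the inverse hidden in \<open>transpose h\<close>; it is cancelled again at the end.\<close>
    have "transpose M ** (transpose h ** J ** h) = transpose P ** J ** h"
      by (simp add: matrix_mul_assoc th)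
    also have "\<dots> = J ** M ** h"
      by (simp add: JM)
    also have "\<dots> = J ** P"
      by (metis Mh matrix_mul_assoc)
    also have "\<dots> = transpose M ** J"
      by (rule JP)
    finally have "transpose M ** (transpose h ** J ** h) = transpose M ** J" .
    moreover have "invertible (transpose M)"
      using M by (rule transpose_invertible)
    ultimately show ?thesis
      by (metis matrix_inv_left matrix_mul_assoc matrix_mul_lid)
  qed
  have "invertible h"
    unfolding h using M P matrix_inv_left matrix_inv_right
    by (metis invertible_def invertible_mult)
  then show ?thesis
    by (simp add: G eq)
qed


section \<open>Transition functions\<close>

text \<open>All other vertices are joined to \<open>ini\<close>, so an edge avoiding
  \<open>ini\<close> would close a triangle in the tree. The RKMK tree is thus a star, and the
  formulas prescribed towards \<open>ini\<close> reach every edge up to orientation.\<close>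

lemma rkmk_edges:
  assumes "stage_tree adj ini fin" "rkmk \<gg> adj ini \<theta>" "adj i j"
  shows "i = ini \<or> j = ini"
proof (rule ccontr)
  assume "\<not> ?thesis"
  moreover have "i \<noteq> j" "symp adj"
    using assms(1,3) by (auto simp: stage_tree_def irreflp_def)
  ultimately have "distinct [i, j, ini]" "successively adj [i, j, ini]" "adj ini i"
    using assms(2,3) by (auto simp: rkmk_def dest: sympD)
  then have "\<exists>p. 3 \<le> length p \<and> distinct p \<and> successively adj p \<and> adj (last p) (hd p)"
    by (intro exI[of _ "[i, j, ini]"]) simp
  then show False
    using assms(1) unfolding stage_tree_def by blast
qed

text \<open>In all three families the transition functions are linear combinations of Lie words in
  the components, and conjugation respects both linear combinations and commutators.\<close>

lemma transition_conjugate: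
  assumes G: "matrix_lie_group G" "g \<in> G" "\<gg> = lie_algebra G"
    and tree: "stage_tree adj ini fin"
    and trans: "transition_functions \<gg> adj \<theta>"
    and skel: "rkmk \<gg> adj ini \<theta> \<or> crouch_grossman \<gg> adj \<theta> \<or> commutator_free \<gg> adj \<theta>"
    and ij: "adj i j" and F: "range F \<subseteq> \<gg>"
  shows "\<theta> i j (\<lambda>l. conjugate g (F l)) = conjugate g (\<theta> i j F)"
proof -
  let ?F = "\<lambda>l. conjugate g (F l)"
  have g: "invertible g"
    using G by (simp add: matrix_lie_group_def)
  have F': "range ?F \<subseteq> \<gg>"
    using F G by (auto intro!: lie_algebra_conjugate)
  note lin = linear_sum[OF linear_conjugate] linear_cmul[OF linear_conjugate]
  from skel show ?thesis
  proof (elim disjE)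
    assume rk: "rkmk \<gg> adj ini \<theta>"
    have to_ini: "\<theta> k ini ?F = conjugate g (\<theta> k ini F)" if "k \<noteq> ini" for k
    proof -
      obtain T c where "\<And>F. range F \<subseteq> \<gg> \<Longrightarrow> \<theta> k ini F = (\<Sum>w\<in>T. (c w :: real) *\<^sub>R eval_word F w)"
        using rk \<open>k \<noteq> ini\<close> unfolding rkmk_def by meson
      then show ?thesis
        by (simp add: F F' lin eval_word_conjugate g)
    qed
    have "i \<noteq> j"
      using tree ij by (auto simp: stage_tree_def irreflp_def)
    then consider "i \<noteq> ini" "j = ini" | "i = ini" "j \<noteq> ini"
      using rkmk_edges[OF tree rk ij] by auto
    then show ?thesis
    proof cases
      case 1
      then show ?thesis by (simp add: to_ini)
    next
      case 2
      \<comment> \<open>The RKMK formula covers only edges directed towards \<open>ini\<close>;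
        skew-symmetry settles the opposite orientation.\<close>
      have "\<theta> i j F = - \<theta> j i F" "\<theta> i j ?F = - \<theta> j i ?F"
        using trans ij F F' unfolding transition_functions_def by blast+
      then show ?thesis
        using 2 by (simp add: to_ini linear_neg[OF linear_conjugate])
    qed
  next
    assume "crouch_grossman \<gg> adj \<theta>"
    then obtain l and c :: real where "\<And>F. range F \<subseteq> \<gg> \<Longrightarrow> \<theta> i j F = c *\<^sub>R F l"
      using ij unfolding crouch_grossman_def by meson
    then show ?thesis
      by (simp add: F F' lin)
  next
    assume "commutator_free \<gg> adj \<theta>"
    then obtain c where "\<And>F. range F \<subseteq> \<gg> \<Longrightarrow> \<theta> i j F = (\<Sum>l\<in>UNIV. (c l :: real) *\<^sub>R F l)"
      using ij unfolding commutator_free_def by meson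
    then show ?thesis
      by (simp add: F F' lin)
  qed
qed


section \<open>Equivariance\<close>

lemma act_field_eq: "act_field act g \<nu> x = conjugate g (\<nu> (act (matrix_inv g) x))"
  by (simp add: act_field_def conjugate_def)

lemma act_matrix_inv:
  assumes "matrix_lie_group G" "smooth_transitive_action A G act" "g \<in> G"
  shows "act (matrix_inv g) (act g x) = x"
proof -
  have "act (matrix_inv g ** g) x = act (matrix_inv g) (act g x)"
    using assms by (simp add: matrix_lie_group_def smooth_transitive_action_def)
  moreover have "matrix_inv g ** g = mat 1" "act (mat 1) x = x"
    using assms by (simp_all add: matrix_lie_group_def smooth_transitive_action_def matrix_inv_left)
  ultimately show ?thesis
    by simp
qed

text \<open>Allows solutions for the transported field to be pulled back to solutions for
  \<open>\<nu>\<close>.\<close>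

lemma act_field_matrix_inv:
  assumes "matrix_lie_group G" "smooth_transitive_action A G act" "g \<in> G"
  shows "act_field act (matrix_inv g) (act_field act g \<nu>) = \<nu>"
proof -
  have "invertible g"
    using assms by (simp add: matrix_lie_group_def)
  then show ?thesis
    by (simp add: act_field_eq fun_eq_iff conjugate_matrix_inv_conjugate matrix_inv_matrix_inv
        act_matrix_inv[OF assms])
qed

text \<open>The edge equations survive because \<open>g ** h\<close> equals
  \<open>conjugate g h ** g\<close>. The action is multiplicative only on \<open>G\<close>, which is
  why the motion \<open>h\<close> must lie there. The hypotheses \<open>conj\<close> and
  \<open>mem\<close> isolate the properties to be checked separately for the exponential and the
  Cayley map.\<close>

lemma stage_solution_act:
  fixes G :: "'n::finite mat set"
  assumes G: "matrix_lie_group G" and act: "smooth_transitive_action A G act" and g: "g \<in> G"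
    and sym: "symp adj"
    and conj: "\<And>i j F h. adj i j \<Longrightarrow> range F \<subseteq> lie_algebra G \<Longrightarrow> \<Psi> i j F = Some h \<Longrightarrow>
      \<Psi> i j (\<lambda>l. conjugate g (F l)) = Some (conjugate g h)"
    and mem: "\<And>i j F h k. adj i j \<Longrightarrow> range F \<subseteq> lie_algebra G \<Longrightarrow> \<Psi> i j F = Some h \<Longrightarrow>
      \<Psi> j i F = Some k \<Longrightarrow> h \<in> G"
    and \<nu>: "range \<nu> \<subseteq> lie_algebra G"
    and sol: "stage_solution act adj ini \<Psi> \<nu> x X F"
  shows "stage_solution act adj ini \<Psi> (act_field act g \<nu>) (act g x)
    (\<lambda>i. act g (X i)) (\<lambda>i. conjugate g (F i))"
proof -
  have F: "range F \<subseteq> lie_algebra G"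
    using sol \<nu> by (auto simp: stage_solution_def)
  have edge: "\<exists>h. \<Psi> i j (\<lambda>l. conjugate g (F l)) = Some h \<and> act g (X i) = act h (act g (X j))"
    if ij: "adj i j" for i j
  proof -
    obtain h where h: "\<Psi> i j F = Some h" "X i = act h (X j)"
      using sol ij unfolding stage_solution_def by blast
    \<comment> \<open>A stage solution has its motions defined along both orientations of an edge;
      the reverse one supplies the extra premise of \<open>mem\<close>.\<close>
    obtain k where "\<Psi> j i F = Some k"
      using sol sympD[OF sym ij] unfolding stage_solution_def by blast
    then have "h \<in> G"
      using mem[OF ij F h(1)] by blast
    have inv: "invertible g" "matrix_inv g \<in> G"
      using G g by (auto simp: matrix_lie_group_def)
    have "conjugate g h \<in> G"
      using G g \<open>h \<in> G\<close> inv unfolding conjugate_def matrix_lie_group_def by blast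
    moreover have "conjugate g h ** g = g ** h"
      by (metis conjugate_def inv(1) matrix_inv_left matrix_mul_assoc matrix_mul_rid)
    moreover have act_mult: "act (a ** b) y = act a (act b y)" if "a \<in> G" "b \<in> G" for a b y
      using act that by (simp add: smooth_transitive_action_def)
    ultimately have "act g (act h (X j)) = act (conjugate g h) (act g (X j))"
      using g \<open>h \<in> G\<close> by (metis act_mult)
    then show ?thesis
      using conj[OF ij F h(1)] h(2) by auto
  qed
  have "X ini = x" "\<And>i. F i = \<nu> (X i)"
    using sol by (simp_all add: stage_solution_def)
  with edge show ?thesis
    by (simp add: stage_solution_def act_field_eq act_matrix_inv[OF G act g])
qed

text \<open>Unique solvability is given for \<open>\<nu>\<close>, whereas the \<open>THE\<close> in
  the skeleton of the transported field needs a unique end point there. Transport by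
  \<open>g\<close> yields existence, and transport back by \<open>matrix_inv g\<close> yields
  uniqueness.\<close>

lemma equivariant_skeletonI:
  fixes G :: "'n::finite mat set"
  assumes G: "matrix_lie_group G" and act: "smooth_transitive_action A G act"
    and sym: "symp adj"
    and conj: "\<And>g i j F h. g \<in> G \<Longrightarrow> adj i j \<Longrightarrow> range F \<subseteq> lie_algebra G \<Longrightarrow> \<Psi> i j F = Some h \<Longrightarrow>
      \<Psi> i j (\<lambda>l. conjugate g (F l)) = Some (conjugate g h)"
    and mem: "\<And>i j F h k. adj i j \<Longrightarrow> range F \<subseteq> lie_algebra G \<Longrightarrow> \<Psi> i j F = Some h \<Longrightarrow>
      \<Psi> j i F = Some k \<Longrightarrow> h \<in> G"
  shows "equivariant_skeleton A G act adj ini fin \<Psi>"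
  unfolding equivariant_skeleton_def
proof (intro ballI allI)
  fix g \<nu> x
  assume g: "g \<in> G" and adm: "\<nu> \<in> admissible_fields A G act adj ini fin \<Psi>"
  have inv: "invertible g" "matrix_inv g \<in> G" "matrix_inv (matrix_inv g) = g"
    using G g by (auto simp: matrix_lie_group_def matrix_inv_matrix_inv)
  have \<nu>: "range \<nu> \<subseteq> lie_algebra G"
    using adm by (simp add: admissible_fields_def smooth_functions_def)
  then have g\<nu>: "range (act_field act g \<nu>) \<subseteq> lie_algebra G"
    by (auto simp: act_field_eq intro!: lie_algebra_conjugate[OF G g])
  have "\<exists>!p. case p of (X, F) \<Rightarrow> stage_solution act adj ini \<Psi> \<nu> x X F"
    using adm unfolding admissible_fields_def by blast
  then obtain p where p: "case p of (X, F) \<Rightarrow> stage_solution act adj ini \<Psi> \<nu> x X F"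
    and p_unique: "\<And>q. case q of (X, F) \<Rightarrow> stage_solution act adj ini \<Psi> \<nu> x X F \<Longrightarrow> q = p"
    by (elim ex1E) metis
  define X F where "X = fst p" and "F = snd p"
  have sol: "stage_solution act adj ini \<Psi> \<nu> x X F"
    using p by (simp add: X_def F_def case_prod_beta)
  have unique: "X' = X" if "stage_solution act adj ini \<Psi> \<nu> x X' F'" for X' F'
    using p_unique[of "(X', F')"] that by (auto simp: X_def)
  have skel: "skeleton act adj ini fin \<Psi> \<nu> x = X fin"
    unfolding skeleton_def
  proof (rule the_equality)
    show "\<exists>X' F'. stage_solution act adj ini \<Psi> \<nu> x X' F' \<and> X fin = X' fin"
      using sol by blast
    show "y = X fin" if "\<exists>X' F'. stage_solution act adj ini \<Psi> \<nu> x X' F' \<and> y = X' fin" for y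
      using that by (elim exE conjE) (drule unique, simp)
  qed
  have act_sol: "stage_solution act adj ini \<Psi> (act_field act k \<mu>) (act k y)
      (\<lambda>i. act k (Y i)) (\<lambda>i. conjugate k (H i))"
    if "k \<in> G" "range \<mu> \<subseteq> lie_algebra G" "stage_solution act adj ini \<Psi> \<mu> y Y H" for k \<mu> y Y H
    by (rule stage_solution_act[OF G act that(1) sym _ _ that(2,3)])
      (erule (2) conj[OF that(1)], erule (3) mem)
  have "skeleton act adj ini fin \<Psi> (act_field act g \<nu>) (act g x) = act g (X fin)"
    unfolding skeleton_def
  proof (rule the_equality)
    show "\<exists>Y H. stage_solution act adj ini \<Psi> (act_field act g \<nu>) (act g x) Y H \<and> act g (X fin) = Y fin"
      using act_sol[OF g \<nu> sol] by blast
  next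
    fix y
    assume "\<exists>Y H. stage_solution act adj ini \<Psi> (act_field act g \<nu>) (act g x) Y H \<and> y = Y fin"
    then obtain Y H where Y: "stage_solution act adj ini \<Psi> (act_field act g \<nu>) (act g x) Y H"
      and y: "y = Y fin"
      by blast
    \<comment> \<open>An arbitrary solution of the transported system is pulled back. Comparing the
      points suffices, since the end point is read off from them alone.\<close>
    have "(\<lambda>i. act (matrix_inv g) (Y i)) = X"
    proof (rule unique)
      show "stage_solution act adj ini \<Psi> \<nu> x (\<lambda>i. act (matrix_inv g) (Y i))
          (\<lambda>i. conjugate (matrix_inv g) (H i))"
        using act_sol[OF inv(2) g\<nu> Y]
        by (simp add: act_field_matrix_inv[OF G act g] act_matrix_inv[OF G act g])
    qed
    then show "y = act g (X fin)"
      using act_matrix_inv[OF G act inv(2), of "Y fin"] unfolding y inv(3) by auto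
  qed
  then show "skeleton act adj ini fin \<Psi> (act_field act g \<nu>) (act g x) =
      act g (skeleton act adj ini fin \<Psi> \<nu> x)"
    by (simp add: skel)
qed

theorem proposition3p3:
  fixes G :: "(real^'n^'n) set"
    and V :: "'e::euclidean_space set"
    and A :: "('m::{t2_space,second_countable_topology} set \<times> ('m \<Rightarrow> 'e)) set"
    and act :: "real^'n^'n \<Rightarrow> 'm \<Rightarrow> 'm"
    and adj :: "'v::finite \<Rightarrow> 'v \<Rightarrow> bool"
    and ini fin :: 'v
    and \<Psi> :: "real^'n^'n \<Rightarrow> (real^'n^'n) option"
    and \<theta> :: "'v \<Rightarrow> 'v \<Rightarrow> ('v \<Rightarrow> real^'n^'n) \<Rightarrow> real^'n^'n"
  assumes "matrix_lie_group G"
    and "smooth_manifold V A"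
    and "smooth_transitive_action A G act"
    and "stage_tree adj ini fin"
    and "\<Psi> = exp_motion \<or> (quadratic_group G \<and> \<Psi> = cayley_motion)"
    and "transition_functions (lie_algebra G) adj \<theta>"
    and "rkmk (lie_algebra G) adj ini \<theta> \<or>
         crouch_grossman (lie_algebra G) adj \<theta> \<or>
         commutator_free (lie_algebra G) adj \<theta>"
  shows "equivariant_skeleton A G act adj ini fin (motions_of \<Psi> \<theta>)"
proof (rule equivariant_skeletonI)
  show "matrix_lie_group G" "smooth_transitive_action A G act" "symp adj"
    using assms by (simp_all add: stage_tree_def)
next
  fix g i j F h
  assume g: "g \<in> G" and ij: "adj i j" and F: "range F \<subseteq> lie_algebra G"
    and h: "motions_of \<Psi> \<theta> i j F = Some h"
  have "invertible g"
    using assms(1) g by (simp add: matrix_lie_group_def)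
  then have "\<Psi> (conjugate g \<xi>) = Some (conjugate g k)" if "\<Psi> \<xi> = Some k" for \<xi> k
    using assms(5) that cayley_motion_conjugate by (auto simp: exp_motion_def matrix_exp_conjugate)
  then show "motions_of \<Psi> \<theta> i j (\<lambda>l. conjugate g (F l)) = Some (conjugate g h)"
    using h transition_conjugate[OF assms(1) g refl assms(4,6,7) ij F] by (simp add: motions_of_def)
next
  fix i j F h k
  assume ij: "adj i j" and F: "range F \<subseteq> lie_algebra G"
    and hk: "motions_of \<Psi> \<theta> i j F = Some h" "motions_of \<Psi> \<theta> j i F = Some k"
  have "adj j i"
    using assms(4) ij by (auto simp: stage_tree_def dest: sympD)
  \<comment> \<open>The reverse motion is \<open>\<Psi>\<close> at the negative argument, so its
    being defined is exactly the definedness at \<open>- \<xi>\<close> required for the Cayley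
    map.\<close>
  then have \<theta>: "\<theta> i j F \<in> lie_algebra G" "\<theta> j i F = - \<theta> i j F"
    using assms(6) ij F unfolding transition_functions_def by blast+
  from assms(5) show "h \<in> G"
  proof
    assume "\<Psi> = exp_motion"
    then show ?thesis
      using hk(1) \<theta>(1) by (auto simp: motions_of_def exp_motion_def intro: matrix_exp_in_group)
  next
    assume "quadratic_group G \<and> \<Psi> = cayley_motion"
    then show ?thesis
      using hk \<theta> cayley_motion_in_quadratic_group[of G "\<theta> i j F" h k] by (simp add: motions_of_def)
  qed
qed

end
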